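(* Let $\mathfrak g$ be a nonzero complete left-symmetric algebra over $\mathbb C$ whose canonical decomposition $\mathfrak g=\bigoplus_\lambda\mathfrak g^\lambda$ satisfies $\dim\mathfrak g^\lambda\le 1$ for all $\lambda$. Then the graph $\Gamma_r$ contains no loops.
   Context: All algebras are finite dimensional. A left-symmetric algebra is a vector space $\mathfrak g$ with a bilinear product such that $x(yz)-(xy)z=y(xz)-(yx)z$ for all $x,y,z$. Then $[x,y]=xy-yx$ is a Lie bracket and $L(x)y=xy$ defines a representation of the Lie algebra $\mathfrak g$. The fields $F_x(y)=xy+x$, $x\in\mathfrak g$, form a Lie algebra of affine vector fields on the space $\mathfrak g$; $\mathfrak g$ is complete if the group of affine transformations generated by their flows acts transitively on $\mathfrak g$. Canonical decomposition: a complete left-symmetric algebra over $\mathbb C$ has a unique Cartan subalgebra $\mathfrak h$ of the Lie algebra $\mathfrak g$ such that, for every linear functional $\lambda$ on $\mathfrak h$, the root subspace (generalized weight space) $\mathfrak g^\lambda$ of $\lambda$ for $L|_{\mathfrak h}$ equals the root subspace for $\operatorname{ad}|_{\mathfrak h}$; the canonical decomposition is $\mathfrak g=\bigoplus_\lambda\mathfrak g^\lambda$, and $\mathfrak g^0=\mathfrak h$. It satisfies $\mathfrak g^\lambda\mathfrak g^\mu\subseteq\mathfrak g^{\lambda+\mu}$. Graphs: assume $\dim\mathfrak g^\lambda\le1$ for all $\lambda$. Fix $e_0\in\mathfrak g^0$, $e_0\neq0$. Identify each functional $\lambda$ with $\mathfrak g^\lambda\ne0$ with the number $\lambda(e_0)$;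 the set of these numbers is $\Lambda\subset\mathbb C$, the spectrum of $L(e_0)$ (it contains $0$). For each $\lambda\in\Lambda$ choose an eigenvector $e_\lambda\in\mathfrak g^\lambda$, $e_0e_\lambda=\lambda e_\lambda$ (with the chosen $e_0$ for $\lambda=0$). In the base $\{e_\lambda\}_{\lambda\in\Lambda}$ the product is $e_\lambda e_\mu=c_{\lambda,\mu}e_{\lambda+\mu}$, with the convention $e_\lambda=0$ and $c_{\lambda,\mu}=c_{\mu,\lambda}=0$ if $\lambda\notin\Lambda$. $\Gamma_r$ is the directed graph with vertex set $\Lambda$ having an edge from $\lambda$ to $\mu$ if and only if $c_{\lambda,\mu-\lambda}\neq0$ (a loop is an edge from a vertex to itself). *)

theory Defs
  imports
    "HOL-Analysis.Analysis"
    "HOL-Algebra.Bij"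
    "HOL-Algebra.Generated_Groups"
    "Graph_Theory.Pair_Digraph"
begin

locale left_symmetric_algebra = vector_space scale
  for scale :: "complex \<Rightarrow> 'a::ab_group_add \<Rightarrow> 'a" (infixr "*s" 75) +
  fixes mul :: "'a \<Rightarrow> 'a \<Rightarrow> 'a" (infixl "\<bullet>\<^sub>s" 72)
  assumes finite_dimensional: "\<exists>B. finite B \<and> span B = UNIV"
    and linear_mul_left: "\<And>x. Vector_Spaces.linear scale scale (\<lambda>y. x \<bullet>\<^sub>s y)"
    and linear_mul_right: "\<And>y. Vector_Spaces.linear scale scale (\<lambda>x. x \<bullet>\<^sub>s y)"
    and left_symmetric:
      "\<And>x y z. x \<bullet>\<^sub>s (y \<bullet>\<^sub>s z) - (x \<bullet>\<^sub>s y) \<bullet>\<^sub>s z = y \<bullet>\<^sub>s (x \<bullet>\<^sub>s z) - (y \<bullet>\<^sub>s x) \<bullet>\<^sub>s z"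
begin

definition lie :: "'a \<Rightarrow> 'a \<Rightarrow> 'a" where
  "lie x y = x \<bullet>\<^sub>s y - y \<bullet>\<^sub>s x"

definition aff_field :: "'a \<Rightarrow> 'a \<Rightarrow> 'a" where
  "aff_field x y = x \<bullet>\<^sub>s y + x"

text \<open>
  The type \<^typ>\<open>'a\<close> carries no topology. As the space is finite dimensional, a curve is
  differentiable with derivative \<open>v\<close> iff this holds after composition with every linear functional.
\<close>

definition integral_curve :: "('a \<Rightarrow> 'a) \<Rightarrow> (real \<Rightarrow> 'a) \<Rightarrow> bool" where
  "integral_curve F \<gamma> \<longleftrightarrow>
     (\<forall>\<phi>. Vector_Spaces.linear scale (*) \<phi> \<longrightarrow>
        (\<forall>t. ((\<lambda>s. \<phi> (\<gamma> s)) has_vector_derivative \<phi> (F (\<gamma> t))) (at t)))"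

definition is_flow_map :: "('a \<Rightarrow> 'a) \<Rightarrow> real \<Rightarrow> ('a \<Rightarrow> 'a) \<Rightarrow> bool" where
  "is_flow_map F t f \<longleftrightarrow> (\<forall>y. \<exists>\<gamma>. integral_curve F \<gamma> \<and> \<gamma> 0 = y \<and> \<gamma> t = f y)"

text \<open>
  Real times suffice: the flow of \<open>F\<^sub>x\<close> at a complex time \<open>c\<close> is the flow of \<open>F\<^bsub>c x\<^esub>\<close> at time \<open>1\<close>.
\<close>

definition affine_group :: "('a \<Rightarrow> 'a) set" where
  "affine_group = generate (BijGroup UNIV) {f. \<exists>x t. is_flow_map (aff_field x) t f}"

definition complete_lsa :: bool where
  "complete_lsa \<longleftrightarrow> (\<forall>y z. \<exists>g\<in>affine_group. g y = z)"

definition lie_subalgebra :: "'a set \<Rightarrow> bool" where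
  "lie_subalgebra h \<longleftrightarrow> subspace h \<and> (\<forall>x\<in>h. \<forall>y\<in>h. lie x y \<in> h)"

primrec lower_central :: "'a set \<Rightarrow> nat \<Rightarrow> 'a set" where
  "lower_central h 0 = h"
| "lower_central h (Suc n) = span {lie x y |x y. x \<in> h \<and> y \<in> lower_central h n}"

definition lie_nilpotent :: "'a set \<Rightarrow> bool" where
  "lie_nilpotent h \<longleftrightarrow> (\<exists>n. lower_central h n = {0})"

definition lie_normalizer :: "'a set \<Rightarrow> 'a set" where
  "lie_normalizer h = {x. \<forall>y\<in>h. lie x y \<in> h}"

definition cartan_subalgebra :: "'a set \<Rightarrow> bool" where
  "cartan_subalgebra h \<longleftrightarrow> lie_subalgebra h \<and> lie_nilpotent h \<and> lie_normalizer h = h"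

text \<open>
  A functional on \<open>h\<close> is represented by any function on the whole space that is linear on \<open>h\<close>;
  its values outside \<open>h\<close> are irrelevant to everything below.
\<close>

definition functional_on :: "'a set \<Rightarrow> ('a \<Rightarrow> complex) \<Rightarrow> bool" where
  "functional_on h \<alpha> \<longleftrightarrow>
     (\<forall>x\<in>h. \<forall>y\<in>h. \<alpha> (x + y) = \<alpha> x + \<alpha> y) \<and> (\<forall>a. \<forall>x\<in>h. \<alpha> (a *s x) = a * \<alpha> x)"

definition root_subspace :: "('a \<Rightarrow> 'a \<Rightarrow> 'a) \<Rightarrow> 'a set \<Rightarrow> ('a \<Rightarrow> complex) \<Rightarrow> 'a set" where
  "root_subspace \<rho> h \<alpha> = {v. \<forall>a\<in>h. \<exists>n. ((\<lambda>w. \<rho> a w - \<alpha> a *s w) ^^ n) v = 0}"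

definition canonical_cartan :: "'a set \<Rightarrow> bool" where
  "canonical_cartan h \<longleftrightarrow> cartan_subalgebra h \<and>
     (\<forall>\<alpha>. functional_on h \<alpha> \<longrightarrow> root_subspace mul h \<alpha> = root_subspace lie h \<alpha>)"

definition canonical_summand :: "'a set \<Rightarrow> ('a \<Rightarrow> complex) \<Rightarrow> 'a set" where
  "canonical_summand h \<alpha> = root_subspace mul h \<alpha>"

definition spectrum :: "'a set \<Rightarrow> 'a \<Rightarrow> complex set" where
  "spectrum h e0 = {\<alpha> e0 |\<alpha>. functional_on h \<alpha> \<and> canonical_summand h \<alpha> \<noteq> {0}}"

definition adapted_base :: "'a set \<Rightarrow> 'a \<Rightarrow> (complex \<Rightarrow> 'a) \<Rightarrow> bool" where
  "adapted_base h e0 e \<longleftrightarrow>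
     e0 \<in> canonical_summand h (\<lambda>_. 0) \<and> e0 \<noteq> 0 \<and> e 0 = e0 \<and>
     (\<forall>\<alpha>. functional_on h \<alpha> \<and> canonical_summand h \<alpha> \<noteq> {0} \<longrightarrow>
        e (\<alpha> e0) \<in> canonical_summand h \<alpha> \<and> e (\<alpha> e0) \<noteq> 0 \<and>
        e0 \<bullet>\<^sub>s e (\<alpha> e0) = \<alpha> e0 *s e (\<alpha> e0)) \<and>
     (\<forall>\<kappa>. \<kappa> \<notin> spectrum h e0 \<longrightarrow> e \<kappa> = 0)"

text \<open>
  The value \<open>c \<kappa> \<mu>\<close> is left undetermined when \<open>\<kappa>\<close> and \<open>\<mu>\<close> are in the spectrum but \<open>\<kappa> + \<mu>\<close> is not;
  such values do not enter the graph.
\<close>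

definition structure_constants ::
    "'a set \<Rightarrow> 'a \<Rightarrow> (complex \<Rightarrow> 'a) \<Rightarrow> (complex \<Rightarrow> complex \<Rightarrow> complex) \<Rightarrow> bool" where
  "structure_constants h e0 e c \<longleftrightarrow>
     (\<forall>\<kappa> \<mu>. e \<kappa> \<bullet>\<^sub>s e \<mu> = c \<kappa> \<mu> *s e (\<kappa> + \<mu>)) \<and>
     (\<forall>\<kappa> \<mu>. \<kappa> \<notin> spectrum h e0 \<longrightarrow> c \<kappa> \<mu> = 0 \<and> c \<mu> \<kappa> = 0)"

end

definition Gamma_r ::
    "complex set \<Rightarrow> (complex \<Rightarrow> complex \<Rightarrow> complex) \<Rightarrow> complex pair_pre_digraph" where
  "Gamma_r \<Lambda> c = \<lparr> pverts = \<Lambda>,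
     parcs = {(\<kappa>, \<mu>). \<kappa> \<in> \<Lambda> \<and> \<mu> \<in> \<Lambda> \<and> c \<kappa> (\<mu> - \<kappa>) \<noteq> 0} \<rparr>"

end

theory Submission
  imports Defs
begin

text \<open>
  A loop of the graph at \<open>v\<close> says that \<open>e v\<close> is an eigenvector of the right multiplication by
  \<open>e 0\<close> with an eigenvalue \<open>k \<noteq> 0\<close>. Then the field \<open>F\<^sub>x\<close> with \<open>x = e v\<close> vanishes at the point
  \<open>y = - e 0 / k\<close>, since \<open>x y = - x\<close>. In a complete algebra this is impossible (\<open>complete_right_mul_eigenvalue_zero\<close>): call a point
  singular if a field \<open>F\<^sub>x\<close> with \<open>x \<noteq> 0\<close> vanishes there. The flow of each \<open>F\<^sub>a\<close> maps singular
  points to singular points, hence so does the whole affine group; as \<open>0\<close> is not singular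
  (\<open>F\<^sub>x(0) = x\<close>), transitivity leaves no singular point at all.

  The invariance (lemma \<open>singular_points_invariant\<close>) reflects that the fields \<open>F\<^sub>x\<close> form a Lie
  algebra, so that the flow of \<open>F\<^sub>a\<close> carries each of them to another one. Concretely, if \<open>F\<^sub>x\<close>
  vanishes at a point of an integral curve \<open>\<gamma>\<close> of \<open>F\<^sub>a\<close>, let \<open>x\<close> evolve by \<open>x' = [a, x]\<close>; left
  symmetry gives the linear equation \<open>w' = a w\<close> for \<open>w(t) = F\<^bsub>x(t)\<^esub>(\<gamma>(t))\<close>, whence \<open>w\<close> is zero
  throughout, while \<open>x(t)\<close> never vanishes. This takes existence and uniqueness for linear
  differential equations (\<open>linear_ode_exists\<close>, \<open>linear_ode_unique\<close>), obtained in coordinates from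
  the exponential series and from Gronwall's inequality.
\<close>

section \<open>Linear differential equations in coordinates\<close>

text \<open>
  The bound makes \<open>E(t) exp(- K t)\<close> nonincreasing and \<open>E(t) exp(K t)\<close> nondecreasing; the first
  settles the times after \<open>s\<close>, the second those before.
\<close>

lemma gronwall_zero:
  fixes E E' :: "real \<Rightarrow> real"
  assumes deriv: "\<And>t. (E has_real_derivative E' t) (at t)"
    and bound: "\<And>t. \<bar>E' t\<bar> \<le> K * E t"
    and nonneg: "\<And>t. 0 \<le> E t"
    and zero: "E s = 0"
  shows "E t = 0"
proof (cases "s \<le> t")
  case True
  have "E t * exp (- K * t) \<le> E s * exp (- K * s)"
  proof (rule DERIV_nonpos_imp_nonincreasing [OF True])
    fix u assume "s \<le> u" "u \<le> t"
    have d: "((\<lambda>u. E u * exp (- K * u)) has_real_derivative (E' u - K * E u) * exp (- K * u)) (at u)"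
      by (rule derivative_eq_intros deriv refl | simp add: algebra_simps)+
    have "(E' u - K * E u) * exp (- K * u) \<le> 0"
      using bound[of u] by (intro mult_nonpos_nonneg) auto
    with d show "\<exists>y. ((\<lambda>u. E u * exp (- K * u)) has_real_derivative y) (at u) \<and> y \<le> 0"
      by blast
  qed
  with zero nonneg[of t] show ?thesis
    by (simp add: mult_le_0_iff)
next
  case False
  have "E t * exp (K * t) \<le> E s * exp (K * s)"
  proof (rule DERIV_nonneg_imp_nondecreasing [where a = t and b = s])
    show "t \<le> s" using False by simp
  next
    fix u assume "t \<le> u" "u \<le> s"
    have d: "((\<lambda>u. E u * exp (K * u)) has_real_derivative (E' u + K * E u) * exp (K * u)) (at u)"
      by (rule derivative_eq_intros deriv refl | simp add: algebra_simps)+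
    have "0 \<le> (E' u + K * E u) * exp (K * u)"
      using bound[of u] by (intro mult_nonneg_nonneg) auto
    with d show "\<exists>y. ((\<lambda>u. E u * exp (K * u)) has_real_derivative y) (at u) \<and> 0 \<le> y"
      by blast
  qed
  with zero nonneg[of t] show ?thesis
    by (simp add: mult_le_0_iff)
qed

context left_symmetric_algebra
begin

definition basis :: "'a set" where
  "basis = (SOME B. finite B \<and> independent B \<and> span B = UNIV)"

definition coord :: "'a \<Rightarrow> 'a \<Rightarrow> complex" where
  "coord b v = representation basis v b"

text \<open>
  The type \<^typ>\<open>'a\<close> has no norm of its own; the \<open>\<ell>\<^sup>1\<close> norm of the coordinates serves for the
  estimates below.
\<close>

definition coord_norm :: "'a \<Rightarrow> real" where
  "coord_norm v = (\<Sum>b\<in>basis. norm (coord b v))"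

lemma basis: "finite basis" "independent basis" "span basis = UNIV"
proof -
  obtain S where S: "finite S" "span S = UNIV"
    using finite_dimensional by blast
  obtain B where "B \<subseteq> S" "independent B" "S \<subseteq> span B"
    using maximal_independent_subset by blast
  with S have "finite B \<and> independent B \<and> span B = UNIV"
    by (metis finite_subset span_mono span_span top.extremum_uniqueI)
  then have "finite basis \<and> independent basis \<and> span basis = UNIV"
    unfolding basis_def by (rule someI)
  then show "finite basis" "independent basis" "span basis = UNIV"
    by auto
qed

lemma linear_coord: "Vector_Spaces.linear scale (*) (coord b)"
  unfolding coord_def using linear_representation[OF basis(2,3)] .

lemma sum_coord: "(\<Sum>b\<in>basis. scale (coord b v) b) = v"
  unfolding coord_def by (rule sum_representation_eq) (use basis in auto)

lemma eq_zero_if_coord_zero: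
  assumes "\<And>b. b \<in> basis \<Longrightarrow> coord b v = 0"
  shows "v = 0"
  using sum_coord[of v] assms by simp

lemma functional_expand:
  assumes "Vector_Spaces.linear scale (*) \<phi>"
  shows "\<phi> v = (\<Sum>b\<in>basis. coord b v * \<phi> b)"
proof -
  interpret f: Vector_Spaces.linear scale "(*)" \<phi> by fact
  show ?thesis
    by (subst sum_coord[of v, symmetric]) (simp add: f.sum f.scale)
qed

lemma functional_bound:
  assumes "Vector_Spaces.linear scale (*) \<phi>"
  shows "norm (\<phi> v) \<le> (\<Sum>b\<in>basis. norm (\<phi> b)) * coord_norm v"
proof -
  have "norm (\<phi> v) \<le> (\<Sum>b\<in>basis. norm (coord b v) * norm (\<phi> b))"
    unfolding functional_expand[OF assms, of v] norm_mult[symmetric] by (rule norm_sum)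
  also have "\<dots> \<le> (\<Sum>b\<in>basis. norm (coord b v) * (\<Sum>b\<in>basis. norm (\<phi> b)))"
    by (intro sum_mono mult_left_mono member_le_sum) (use basis in auto)
  finally show ?thesis
    unfolding coord_norm_def by (simp only: sum_distrib_right[symmetric] mult.commute)
qed

lemma linear_functional_comp:
  assumes "Vector_Spaces.linear scale (*) \<phi>" "Vector_Spaces.linear scale scale A"
  shows "Vector_Spaces.linear scale (*) (\<lambda>v. \<phi> (A v))"
  using Vector_Spaces.linear_compose[OF assms(2,1)] by (simp add: o_def)

lemma coord_norm_nonneg: "0 \<le> coord_norm v"
  by (simp add: coord_norm_def sum_nonneg)

lemma operator_bound:
  assumes "Vector_Spaces.linear scale scale A"
  obtains K where "0 \<le> K" "\<And>v. coord_norm (A v) \<le> K * coord_norm v"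
proof
  let ?K = "\<Sum>b\<in>basis. \<Sum>b'\<in>basis. norm (coord b (A b'))"
  show "0 \<le> ?K" by (simp add: sum_nonneg)
  show "coord_norm (A v) \<le> ?K * coord_norm v" for v
    unfolding coord_norm_def[of "A v"] sum_distrib_right[of _ basis "coord_norm v"]
    using functional_bound[OF linear_functional_comp[OF linear_coord assms]]
    by (intro sum_mono) (simp add: sum_distrib_right)
qed

lemma operator_power_bound:
  assumes "\<And>v. coord_norm (A v) \<le> K * coord_norm v" "0 \<le> K"
  shows "coord_norm ((A ^^ n) v) \<le> K ^ n * coord_norm v"
proof (induction n)
  case (Suc n)
  have "coord_norm ((A ^^ Suc n) v) \<le> K * coord_norm ((A ^^ n) v)"
    using assms by simp
  also have "\<dots> \<le> K * (K ^ n * coord_norm v)"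
    using Suc assms by (intro mult_left_mono)
  finally show ?case by (simp add: mult.assoc)
qed simp

text \<open>
  Gronwall's argument applies to the sum \<open>E\<close> of the squared moduli of the coordinates of \<open>w\<close>:
  its derivative is a quadratic expression in these coordinates, hence at most a multiple of \<open>E\<close>.
\<close>

lemma linear_ode_unique:
  assumes A: "Vector_Spaces.linear scale scale A"
    and w: "integral_curve A w" and zero: "w s = 0"
  shows "w t = 0"
proof -
  obtain K where K: "0 \<le> K" "\<And>v. coord_norm (A v) \<le> K * coord_norm v"
    using operator_bound[OF A] by blast
  define E where "E t = (\<Sum>b\<in>basis. coord b (w t) \<bullet> coord b (w t))" for t
  define E' where "E' t = (\<Sum>b\<in>basis. 2 * (coord b (w t) \<bullet> coord b (A (w t))))" for t
  have "((\<lambda>s. coord b (w s)) has_vector_derivative coord b (A (w t))) (at t)" for b t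
    using w linear_coord unfolding integral_curve_def by blast
  then have "((\<lambda>s. coord b (w s) \<bullet> coord b (w s)) has_real_derivative
      2 * (coord b (w t) \<bullet> coord b (A (w t)))) (at t)" for b t
    unfolding has_vector_derivative_def has_field_derivative_def
    by (auto intro!: derivative_eq_intros simp: inner_commute fun_eq_iff)
  then have deriv: "(E has_real_derivative E' t) (at t)" for t
    unfolding E_def E'_def by (intro DERIV_sum)
  have bound: "\<bar>E' t\<bar> \<le> (2 * K * card basis) * E t" for t
  proof -
    have "\<bar>E' t\<bar> \<le> (\<Sum>b\<in>basis. \<bar>2 * (coord b (w t) \<bullet> coord b (A (w t)))\<bar>)"
      unfolding E'_def by (rule sum_abs)
    also have "\<dots> \<le> (\<Sum>b\<in>basis. 2 * (coord_norm (w t) * norm (coord b (A (w t)))))"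
    proof (rule sum_mono)
      fix b assume b: "b \<in> basis"
      have "\<bar>coord b (w t) \<bullet> coord b (A (w t))\<bar> \<le> norm (coord b (w t)) * norm (coord b (A (w t)))"
        by (rule Cauchy_Schwarz_ineq2)
      also have "\<dots> \<le> coord_norm (w t) * norm (coord b (A (w t)))"
        unfolding coord_norm_def using basis b by (intro mult_right_mono member_le_sum) auto
      finally show "\<bar>2 * (coord b (w t) \<bullet> coord b (A (w t)))\<bar>
          \<le> 2 * (coord_norm (w t) * norm (coord b (A (w t))))"
        by (simp add: abs_mult)
    qed
    also have "\<dots> = 2 * (coord_norm (w t) * coord_norm (A (w t)))"
      by (simp add: coord_norm_def[of "A (w t)"] sum_distrib_left)
    also have "\<dots> \<le> 2 * (coord_norm (w t) * (K * coord_norm (w t)))"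
      using K coord_norm_nonneg by (intro mult_left_mono) auto
    also have "\<dots> = 2 * K * (coord_norm (w t))\<^sup>2"
      by (simp add: power2_eq_square)
    also have "\<dots> \<le> 2 * K * (E t * card basis)"
      unfolding coord_norm_def E_def power2_norm_eq_inner[symmetric]
      using K by (intro mult_left_mono sum_squared_le_sum_of_squares) auto
    finally show ?thesis by (simp add: mult_ac)
  qed
  interpret c: Vector_Spaces.linear scale "(*)" "coord b" for b by (rule linear_coord)
  have nonneg: "0 \<le> E t" for t
    by (simp add: E_def sum_nonneg)
  have "E s = 0"
    by (simp add: E_def zero c.zero)
  then have "E t = 0"
    by (rule gronwall_zero[OF deriv bound nonneg])
  then show ?thesis
    unfolding E_def by (intro eq_zero_if_coord_zero) (simp add: sum_nonneg_eq_0_iff basis(1))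
qed

text \<open>
  The solution is \<open>exp(t A) x0\<close>. Its series cannot be summed in \<^typ>\<open>'a\<close>, so it is summed in
  each coordinate; the resulting curve \<open>x\<close> then satisfies \<open>\<phi>(x(t)) = \<Sum>n. \<phi>(A\<^sup>n x0) t\<^sup>n / n!\<close>
  for every functional \<open>\<phi>\<close>, and this is a power series that can be differentiated termwise.
\<close>

lemma linear_ode_exists:
  assumes A: "Vector_Spaces.linear scale scale A"
  shows "\<exists>x. integral_curve A x \<and> x 0 = x0"
proof -
  obtain K where K: "0 \<le> K" "\<And>v. coord_norm (A v) \<le> K * coord_norm v"
    using operator_bound[OF A] by blast
  define S where "S \<phi> z = (\<Sum>n. \<phi> ((A ^^ n) x0) / fact n * z ^ n)" for \<phi> and z :: complex
  have summ: "summable (\<lambda>n. \<phi> ((A ^^ n) x0) / fact n * z ^ n)"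
    if \<phi>: "Vector_Spaces.linear scale (*) \<phi>" for \<phi> and z :: complex
  proof (rule summable_comparison_test)
    let ?C = "(\<Sum>b\<in>basis. norm (\<phi> b)) * coord_norm x0"
    show "\<exists>N. \<forall>n\<ge>N. norm (\<phi> ((A ^^ n) x0) / fact n * z ^ n) \<le> ?C * ((K * norm z) ^ n /\<^sub>R fact n)"
    proof (intro exI allI impI)
      fix n
      have "norm (\<phi> ((A ^^ n) x0)) \<le> (\<Sum>b\<in>basis. norm (\<phi> b)) * coord_norm ((A ^^ n) x0)"
        by (rule functional_bound[OF \<phi>])
      also have "\<dots> \<le> (\<Sum>b\<in>basis. norm (\<phi> b)) * (K ^ n * coord_norm x0)"
        using K by (intro mult_left_mono operator_power_bound) (auto simp: sum_nonneg)
      finally have "norm (\<phi> ((A ^^ n) x0)) * (norm z ^ n / fact n) \<le> ?C * K ^ n * (norm z ^ n / fact n)"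
        by (intro mult_right_mono) (auto simp: mult_ac)
      then show "norm (\<phi> ((A ^^ n) x0) / fact n * z ^ n) \<le> ?C * ((K * norm z) ^ n /\<^sub>R fact n)"
        by (simp add: norm_mult norm_divide norm_power power_mult_distrib field_simps)
    qed
    show "summable (\<lambda>n. ?C * ((K * norm z) ^ n /\<^sub>R fact n))"
      by (intro summable_mult summable_exp_generic)
  qed
  define x where "x t = (\<Sum>b\<in>basis. scale (S (coord b) (of_real t)) b)" for t :: real
  have \<phi>x: "\<phi> (x t) = S \<phi> (of_real t)" if \<phi>: "Vector_Spaces.linear scale (*) \<phi>" for \<phi> t
  proof -
    interpret f: Vector_Spaces.linear scale "(*)" \<phi> by fact
    have "\<phi> (x t) = (\<Sum>b\<in>basis. \<phi> b * S (coord b) (of_real t))"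
      by (simp add: x_def f.sum f.scale mult.commute)
    also have "\<dots> = (\<Sum>b\<in>basis. \<Sum>n. \<phi> b * (coord b ((A ^^ n) x0) / fact n * of_real t ^ n))"
      unfolding S_def by (intro sum.cong refl suminf_mult[symmetric] summ linear_coord)
    also have "\<dots> = (\<Sum>n. \<Sum>b\<in>basis. \<phi> b * (coord b ((A ^^ n) x0) / fact n * of_real t ^ n))"
      by (intro suminf_sum[symmetric] summable_mult summ linear_coord)
    also have "\<dots> = (\<Sum>n. (\<Sum>b\<in>basis. coord b ((A ^^ n) x0) * \<phi> b) / fact n * of_real t ^ n)"
      unfolding sum_divide_distrib sum_distrib_right
      by (intro arg_cong[where f = suminf] ext sum.cong) simp_all
    also have "\<dots> = S \<phi> (of_real t)"
      unfolding S_def functional_expand[OF \<phi>, symmetric] ..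
    finally show ?thesis .
  qed
  have "integral_curve A x"
    unfolding integral_curve_def
  proof (intro allI impI)
    fix \<phi> t assume \<phi>: "Vector_Spaces.linear scale (*) \<phi>"
    have "(S \<phi> has_field_derivative (\<Sum>n. diffs (\<lambda>n. \<phi> ((A ^^ n) x0) / fact n) n * of_real t ^ n))
        (at (of_real t))"
      unfolding S_def by (intro termdiffs_strong_converges_everywhere summ \<phi>)
    also have "diffs (\<lambda>n. \<phi> ((A ^^ n) x0) / fact n) = (\<lambda>n. \<phi> (A ((A ^^ n) x0)) / fact n)"
      by (auto simp: diffs_def fun_eq_iff field_simps simp del: of_nat_Suc)
    also have "(\<Sum>n. \<phi> (A ((A ^^ n) x0)) / fact n * of_real t ^ n) = \<phi> (A (x t))"
      using \<phi>x[OF linear_functional_comp[OF \<phi> A], of t] by (simp add: S_def)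
    finally have "((\<lambda>s. S \<phi> (of_real s)) has_vector_derivative \<phi> (A (x t))) (at t)"
      by (rule has_vector_derivative_real_field)
    then show "((\<lambda>s. \<phi> (x s)) has_vector_derivative \<phi> (A (x t))) (at t)"
      by (simp add: \<phi>x[OF \<phi>])
  qed
  moreover have "x 0 = x0"
    by (simp add: x_def S_def powser_zero sum_coord del: times_divide_eq_left)
  ultimately show ?thesis by blast
qed

section \<open>Invariance of singular points under the affine group\<close>

lemma integral_curve_shift:
  assumes "integral_curve F \<gamma>"
  shows "integral_curve F (\<lambda>t. \<gamma> (t + s))"
  unfolding integral_curve_def
proof (intro allI impI)
  fix \<phi> t assume "Vector_Spaces.linear scale (*) \<phi>"
  then have "((\<lambda>u. \<phi> (\<gamma> u)) has_vector_derivative \<phi> (F (\<gamma> (t + s)))) (at (t + s))"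
    using assms unfolding integral_curve_def by blast
  then have "(((\<lambda>u. \<phi> (\<gamma> u)) \<circ> (\<lambda>u. u + s)) has_vector_derivative 1 *\<^sub>R \<phi> (F (\<gamma> (t + s)))) (at t)"
    by (intro vector_diff_chain_at) (auto intro!: derivative_eq_intros)
  then show "((\<lambda>u. \<phi> (\<gamma> (u + s))) has_vector_derivative \<phi> (F (\<gamma> (t + s)))) (at t)"
    by (simp add: o_def)
qed

lemma mul_add_left: "x \<bullet>\<^sub>s (y + z) = x \<bullet>\<^sub>s y + x \<bullet>\<^sub>s z"
  and mul_scale_left: "x \<bullet>\<^sub>s scale k y = scale k (x \<bullet>\<^sub>s y)"
  and mul_add_right: "(x + y) \<bullet>\<^sub>s z = x \<bullet>\<^sub>s z + y \<bullet>\<^sub>s z"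
  and mul_scale_right: "scale k x \<bullet>\<^sub>s z = scale k (x \<bullet>\<^sub>s z)"
  and mul_diff_left: "x \<bullet>\<^sub>s (y - z) = x \<bullet>\<^sub>s y - x \<bullet>\<^sub>s z"
  and mul_diff_right: "(x - y) \<bullet>\<^sub>s z = x \<bullet>\<^sub>s z - y \<bullet>\<^sub>s z"
  and mul_zero_left: "x \<bullet>\<^sub>s 0 = 0"
proof -
  interpret l: Vector_Spaces.linear scale scale "\<lambda>y. x \<bullet>\<^sub>s y" for x by (rule linear_mul_left)
  interpret r: Vector_Spaces.linear scale scale "\<lambda>x. x \<bullet>\<^sub>s y" for y by (rule linear_mul_right)
  show "x \<bullet>\<^sub>s (y + z) = x \<bullet>\<^sub>s y + x \<bullet>\<^sub>s z" "x \<bullet>\<^sub>s scale k y = scale k (x \<bullet>\<^sub>s y)"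
    "(x + y) \<bullet>\<^sub>s z = x \<bullet>\<^sub>s z + y \<bullet>\<^sub>s z" "scale k x \<bullet>\<^sub>s z = scale k (x \<bullet>\<^sub>s z)"
    "x \<bullet>\<^sub>s (y - z) = x \<bullet>\<^sub>s y - x \<bullet>\<^sub>s z" "(x - y) \<bullet>\<^sub>s z = x \<bullet>\<^sub>s z - y \<bullet>\<^sub>s z" "x \<bullet>\<^sub>s 0 = 0"
    by (fact l.add l.scale r.add r.scale l.diff r.diff l.zero)+
qed

lemma linear_lie: "Vector_Spaces.linear scale scale (lie a)"
  unfolding Vector_Spaces.linear_iff lie_def
  by (auto simp: vector_space_axioms mul_add_left mul_add_right mul_scale_left mul_scale_right
      scale_right_diff_distrib)

text \<open>The difference of two integral curves solves the linear equation \<open>z' = a z\<close>.\<close>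

lemma integral_curve_affine_unique:
  assumes "integral_curve (aff_field a) \<gamma>" "integral_curve (aff_field a) \<delta>" "\<gamma> s = \<delta> s"
  shows "\<gamma> t = \<delta> t"
proof -
  have "integral_curve (\<lambda>z. a \<bullet>\<^sub>s z) (\<lambda>t. \<gamma> t - \<delta> t)"
    unfolding integral_curve_def
  proof (intro allI impI)
    fix \<phi> t assume \<phi>: "Vector_Spaces.linear scale (*) \<phi>"
    interpret f: Vector_Spaces.linear scale "(*)" \<phi> by fact
    have "((\<lambda>s. \<phi> (\<gamma> s) - \<phi> (\<delta> s)) has_vector_derivative
        \<phi> (aff_field a (\<gamma> t)) - \<phi> (aff_field a (\<delta> t))) (at t)"
      using assms \<phi> unfolding integral_curve_def by (intro has_vector_derivative_diff) blast+
    then show "((\<lambda>s. \<phi> (\<gamma> s - \<delta> s)) has_vector_derivative \<phi> (a \<bullet>\<^sub>s (\<gamma> t - \<delta> t))) (at t)"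
      by (simp add: aff_field_def f.diff f.add mul_diff_left)
  qed
  from linear_ode_unique[OF linear_mul_left this, of s t] assms(3) show ?thesis by simp
qed

text \<open>
  These are the points \<open>y\<close> at which \<open>1 + R(y)\<close> is not invertible, where \<open>R(y)\<close> is the right
  multiplication by \<open>y\<close>: the zeros of the polynomial \<open>det (1 + R(y))\<close>.
\<close>

definition singular_points :: "'a set" where
  "singular_points = {y. \<exists>x. x \<noteq> 0 \<and> aff_field x y = 0}"

text \<open>
  Expanding the left factor in the basis reduces the Leibniz rule to the one for products of
  complex functions.
\<close>

lemma product_curve_derivative:
  assumes \<phi>: "Vector_Spaces.linear scale (*) \<phi>"
    and x: "integral_curve F x" and y: "integral_curve G y"
  shows "((\<lambda>s. \<phi> (x s \<bullet>\<^sub>s y s)) has_vector_derivative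
    \<phi> (F (x t) \<bullet>\<^sub>s y t) + \<phi> (x t \<bullet>\<^sub>s G (y t))) (at t)"
proof -
  interpret f: Vector_Spaces.linear scale "(*)" \<phi> by fact
  have r: "Vector_Spaces.linear scale (*) (\<lambda>v. \<phi> (v \<bullet>\<^sub>s z))" for z
    by (rule linear_functional_comp[OF \<phi> linear_mul_right])
  have l: "Vector_Spaces.linear scale (*) (\<lambda>v. \<phi> (z \<bullet>\<^sub>s v))" for z
    by (rule linear_functional_comp[OF \<phi> linear_mul_left])
  have expand: "\<phi> (u \<bullet>\<^sub>s v) = (\<Sum>b\<in>basis. coord b u * \<phi> (b \<bullet>\<^sub>s v))" for u v
    using functional_expand[OF r] .
  have "((\<lambda>s. \<Sum>b\<in>basis. coord b (x s) * \<phi> (b \<bullet>\<^sub>s y s)) has_vector_derivative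
      (\<Sum>b\<in>basis. coord b (x t) * \<phi> (b \<bullet>\<^sub>s G (y t)) + coord b (F (x t)) * \<phi> (b \<bullet>\<^sub>s y t))) (at t)"
    using x y l linear_coord unfolding integral_curve_def
    by (intro has_vector_derivative_sum has_vector_derivative_mult) blast+
  then show ?thesis
    by (simp add: expand[symmetric] sum.distrib add.commute)
qed

text \<open>
  Let \<open>x\<close> evolve by \<open>x' = [a, x]\<close>, and put \<open>w = x \<gamma> + x\<close>. The Leibniz rule gives
  \<open>w' = [a, x] \<gamma> + x (a \<gamma> + a) + [a, x]\<close>, and left symmetry in the form
  \<open>[a, x] \<gamma> = a (x \<gamma>) - x (a \<gamma>)\<close> reduces this to \<open>w' = a w\<close>. Uniqueness for this equation keeps
  \<open>w\<close> at zero, and uniqueness for the equation of \<open>x\<close> keeps \<open>x\<close> away from zero.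
\<close>

lemma singular_points_invariant:
  assumes \<gamma>: "integral_curve (aff_field a) \<gamma>" and sing: "\<gamma> s \<in> singular_points"
  shows "\<gamma> t \<in> singular_points"
proof -
  obtain x0 where x0: "x0 \<noteq> 0" "aff_field x0 (\<gamma> s) = 0"
    using sing by (auto simp: singular_points_def)
  obtain \<xi> where \<xi>: "integral_curve (lie a) \<xi>" "\<xi> 0 = x0"
    using linear_ode_exists[OF linear_lie] by blast
  define x where "x t = \<xi> (t + - s)" for t
  have x: "integral_curve (lie a) x" "x s = x0"
    unfolding x_def using integral_curve_shift[OF \<xi>(1), of "- s"] \<xi>(2) by simp_all
  have "integral_curve (\<lambda>z. a \<bullet>\<^sub>s z) (\<lambda>t. aff_field (x t) (\<gamma> t))"
    unfolding integral_curve_def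
  proof (intro allI impI)
    fix \<phi> t assume \<phi>: "Vector_Spaces.linear scale (*) \<phi>"
    interpret f: Vector_Spaces.linear scale "(*)" \<phi> by fact
    have "((\<lambda>s. \<phi> (x s)) has_vector_derivative \<phi> (lie a (x t))) (at t)"
      using x(1) \<phi> unfolding integral_curve_def by blast
    with product_curve_derivative[OF \<phi> x(1) \<gamma>]
    have "((\<lambda>s. \<phi> (x s \<bullet>\<^sub>s \<gamma> s) + \<phi> (x s)) has_vector_derivative
      (\<phi> (lie a (x t) \<bullet>\<^sub>s \<gamma> t) + \<phi> (x t \<bullet>\<^sub>s aff_field a (\<gamma> t))) + \<phi> (lie a (x t))) (at t)"
      by (rule has_vector_derivative_add)
    moreover have "lie a (x t) \<bullet>\<^sub>s \<gamma> t + x t \<bullet>\<^sub>s aff_field a (\<gamma> t) + lie a (x t)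
        = a \<bullet>\<^sub>s aff_field (x t) (\<gamma> t)"
      using left_symmetric[of a "x t" "\<gamma> t"]
      by (simp add: lie_def aff_field_def mul_add_left mul_diff_right algebra_simps)
    ultimately show "((\<lambda>s. \<phi> (aff_field (x s) (\<gamma> s))) has_vector_derivative
        \<phi> (a \<bullet>\<^sub>s aff_field (x t) (\<gamma> t))) (at t)"
      by (simp add: aff_field_def[of "x _"] f.add[symmetric])
  qed
  from linear_ode_unique[OF linear_mul_left this, of s t] x(2) x0(2)
  have "aff_field (x t) (\<gamma> t) = 0" by simp
  moreover have "x t \<noteq> 0"
    using linear_ode_unique[OF linear_lie x(1), of t s] x(2) x0(1) by auto
  ultimately show ?thesis by (auto simp: singular_points_def)
qed

text \<open>
  A flow map that were not bijective would have an unspecified inverse in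
  \<^const>\<open>BijGroup\<close>, so bijectivity has to be established before inverses can be treated.
  For surjectivity, follow the integral curve of \<open>z\<close> backwards for the time \<open>t\<close>.
\<close>

lemma bij_flow_map:
  assumes f: "is_flow_map (aff_field a) t f"
  shows "bij f"
proof (rule bijI)
  show "inj f"
  proof (rule injI)
    fix y y' assume eq: "f y = f y'"
    obtain \<gamma> \<delta> where "integral_curve (aff_field a) \<gamma>" "\<gamma> 0 = y" "\<gamma> t = f y"
      "integral_curve (aff_field a) \<delta>" "\<delta> 0 = y'" "\<delta> t = f y'"
      using f unfolding is_flow_map_def by metis
    with eq integral_curve_affine_unique[of a \<gamma> \<delta> t 0] show "y = y'" by simp
  qed
  show "surj f"
    unfolding surj_def
  proof
    fix z
    obtain \<gamma> where \<gamma>: "integral_curve (aff_field a) \<gamma>" "\<gamma> 0 = z"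
      using f unfolding is_flow_map_def by metis
    obtain \<delta> where \<delta>: "integral_curve (aff_field a) \<delta>" "\<delta> 0 = \<gamma> (- t)" "\<delta> t = f (\<gamma> (- t))"
      using f unfolding is_flow_map_def by metis
    have "\<delta> t = \<gamma> (t + - t)"
      by (rule integral_curve_affine_unique[OF \<delta>(1) integral_curve_shift[OF \<gamma>(1)], of 0]) (simp add: \<delta>)
    with \<gamma> \<delta> have "f (\<gamma> (- t)) = z" by simp
    then show "\<exists>y. z = f y" by metis
  qed
qed

lemma affine_group_singular_points:
  assumes "g \<in> affine_group"
  shows "bij g \<and> (\<forall>y. g y \<in> singular_points \<longleftrightarrow> y \<in> singular_points)"
proof -
  have flow: "bij f \<and> (\<forall>y. f y \<in> singular_points \<longleftrightarrow> y \<in> singular_points)"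
    if f: "is_flow_map (aff_field a) t f" for a t f
  proof (intro conjI allI bij_flow_map[OF f])
    fix y
    obtain \<gamma> where "integral_curve (aff_field a) \<gamma>" "\<gamma> 0 = y" "\<gamma> t = f y"
      using f unfolding is_flow_map_def by metis
    then show "f y \<in> singular_points \<longleftrightarrow> y \<in> singular_points"
      using singular_points_invariant[of a \<gamma> 0 t] singular_points_invariant[of a \<gamma> t 0] by auto
  qed
  have Bij: "Bij UNIV = {g :: 'a \<Rightarrow> 'a. bij g}"
    by (simp add: Bij_def extensional_def)
  show ?thesis
    using assms unfolding affine_group_def
  proof (induction rule: generate.induct)
    case one
    have "\<one>\<^bsub>BijGroup (UNIV :: 'a set)\<^esub> = id"
      by (simp add: BijGroup_def restrict_def fun_eq_iff)
    then show ?case by (metis bij_id id_apply)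
  next
    case (incl f)
    then show ?case using flow by blast
  next
    case (inv f)
    then have f: "bij f" "\<And>y. f y \<in> singular_points \<longleftrightarrow> y \<in> singular_points"
      using flow by blast+
    then have "m_inv (BijGroup UNIV) f = Hilbert_Choice.inv f"
      by (subst inv_BijGroup) (auto simp: Bij restrict_def)
    moreover have "f (Hilbert_Choice.inv f y) = y" for y
      using f(1) by (simp add: bij_is_surj surj_f_inv_f)
    ultimately show ?case
      using f(2)[of "Hilbert_Choice.inv f _"] bij_imp_bij_inv[OF f(1)] by simp
  next
    case (eng g1 g2)
    then have "g1 \<otimes>\<^bsub>BijGroup UNIV\<^esub> g2 = g1 \<circ> g2"
      by (simp add: BijGroup_def Bij compose_def restrict_def fun_eq_iff)
    with eng show ?case by (metis bij_comp o_apply)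
  qed
qed

theorem complete_imp_singular_points_empty:
  assumes complete_lsa
  shows "singular_points = {}"
proof -
  have "0 \<notin> singular_points"
    by (auto simp: singular_points_def aff_field_def mul_zero_left)
  moreover have "z \<in> singular_points \<longleftrightarrow> 0 \<in> singular_points" for z
  proof -
    obtain g where "g \<in> affine_group" "g 0 = z"
      using assms unfolding complete_lsa_def by metis
    with affine_group_singular_points[of g] show ?thesis by auto
  qed
  ultimately show ?thesis by auto
qed

text \<open>
  If \<open>x y = k x\<close> with \<open>k \<noteq> 0\<close>, rescaling \<open>y\<close> to \<open>- y / k\<close> turns the eigenvalue into \<open>- 1\<close>, which
  is what makes the field of \<open>x\<close> vanish.
\<close>

corollary complete_right_mul_eigenvalue_zero:
  assumes "complete_lsa" "x \<noteq> 0" "x \<bullet>\<^sub>s y = scale k x"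
  shows "k = 0"
proof (rule ccontr)
  assume "k \<noteq> 0"
  then have "x \<bullet>\<^sub>s scale (- inverse k) y = scale (- 1) x"
    using assms(3) by (simp add: mul_scale_left del: scale_minus_left)
  then have "aff_field x (scale (- inverse k) y) = 0"
    by (simp add: aff_field_def)
  with assms(2) have "scale (- inverse k) y \<in> singular_points"
    by (auto simp: singular_points_def)
  with complete_imp_singular_points_empty[OF assms(1)] show False by simp
qed

end

theorem mainTheorem4:
  fixes scale :: "complex \<Rightarrow> 'a::ab_group_add \<Rightarrow> 'a"
    and mul :: "'a \<Rightarrow> 'a \<Rightarrow> 'a"
    and h :: "'a set" and e0 :: 'a
    and e :: "complex \<Rightarrow> 'a"
    and c :: "complex \<Rightarrow> complex \<Rightarrow> complex"
  assumes "left_symmetric_algebra scale mul"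
    and "(UNIV :: 'a set) \<noteq> {0}"
    and "left_symmetric_algebra.complete_lsa scale mul"
    and "left_symmetric_algebra.canonical_cartan scale mul h"
    and "\<And>\<alpha>. left_symmetric_algebra.functional_on scale h \<alpha> \<Longrightarrow>
           vector_space.dim scale (left_symmetric_algebra.canonical_summand scale mul h \<alpha>) \<le> 1"
    and "left_symmetric_algebra.adapted_base scale mul h e0 e"
    and "left_symmetric_algebra.structure_constants scale mul h e0 e c"
  shows "\<forall>v \<in> pverts (Gamma_r (left_symmetric_algebra.spectrum scale mul h e0) c).
           (v, v) \<notin> parcs (Gamma_r (left_symmetric_algebra.spectrum scale mul h e0) c)"
proof -
  interpret left_symmetric_algebra scale mul by fact
  have complete: complete_lsa and base: "adapted_base h e0 e" and sc: "structure_constants h e0 e c"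
    using assms by auto
  have "c v 0 = 0" if "v \<in> spectrum h e0" for v
  proof (rule complete_right_mul_eigenvalue_zero[OF complete])
    show "e v \<noteq> 0"
      using that base unfolding spectrum_def adapted_base_def by blast
    show "mul (e v) (e 0) = scale (c v 0) (e v)"
      using sc unfolding structure_constants_def by (metis add_0_right)
  qed
  then show ?thesis
    by (auto simp: Gamma_r_def)
qed

end
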